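(* Let $I\subseteq\mathbb{R}$ be an interval, let $a,b\in I$ with $a<b$, let $x,y$ satisfy $a\leq x\leq y\leq b$, and let $f:I\rightarrow\mathbb{R}$ be an $M$-Lipschitzian function. Let $\alpha>0$, $\lambda\in[0,1]$ and $V=(1-\lambda)a+\lambda b$. Define $V_{\alpha,\lambda}(x,y)$ as follows. (1) If $a\leq V\leq x\leq y\leq b$, then $$V_{\alpha,\lambda}(x,y)=(V-a)^{\alpha}\left[\frac{x-a}{\alpha}-\frac{V-a}{\alpha+1}\right]+\frac{2(b-y)^{\alpha+1}}{\alpha(\alpha+1)}+(b-V)^{\alpha}\left[\frac{b-V}{\alpha+1}-\frac{b-y}{\alpha}\right].$$ (2) If $a\leq x\leq V\leq y\leq b$, then $$V_{\alpha,\lambda}(x,y)=\frac{2(x-a)^{\alpha+1}}{\alpha(\alpha+1)}+(V-a)^{\alpha}\left[\frac{V-a}{\alpha+1}-\frac{x-a}{\alpha}\right]+\frac{2(b-y)^{\alpha+1}}{\alpha(\alpha+1)}+(b-V)^{\alpha}\left[\frac{b-V}{\alpha+1}-\frac{b-y}{\alpha}\right].$$ (3) If $a\leq x\leq y\leq V\leq b$, then $$V_{\alpha,\lambda}(x,y)=\frac{2(x-a)^{\alpha+1}}{\alpha(\alpha+1)}+(V-a)^{\alpha}\left[\frac{V-a}{\alpha+1}-\frac{x-a}{\alpha}\right]+(b-V)^{\alpha}\left[\frac{b-y}{\alpha}-\frac{b-V}{\alpha+1}\right].$$ Then $$\left|\lambda^{\alpha}f(x)+(1-\lambda)^{\alpha}f(y)-\frac{\Gamma(\alpha+1)}{(b-a)^{\alpha}}\left[J_{V-}^{\alpha}f(a)+J_{V+}^{\alpha}f(b)\right]\right|\leq\frac{\alpha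 M\,V_{\alpha,\lambda}(x,y)}{(b-a)^{\alpha}}.$$
   Context: A function $f:I\rightarrow\mathbb{R}$ on an interval $I$ is called $M$-Lipschitzian, with $M\geq 0$, if $|f(s)-f(t)|\leq M|s-t|$ for all $s,t\in I$. Riemann-Liouville fractional integrals of order $\alpha>0$: for real $c<d$ and $f$ integrable on $[c,d]$, $$J_{c+}^{\alpha}f(d)=\frac{1}{\Gamma(\alpha)}\int_{c}^{d}(d-t)^{\alpha-1}f(t)\,dt,\qquad J_{d-}^{\alpha}f(c)=\frac{1}{\Gamma(\alpha)}\int_{c}^{d}(t-c)^{\alpha-1}f(t)\,dt,$$ where $\Gamma$ is the Gamma function. When $c=d$ these integrals are taken to be $0$. Also $0^{\alpha}=0$ for $\alpha>0$. *)

theory Defs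
  imports "HOL-Analysis.Analysis"
begin

text \<open>
  Left-sided and right-sided Riemann--Liouville fractional integrals, as Lebesgue integrals.
  \<open>RL_left \<alpha> c f d\<close> is $J_{c+}^{\alpha} f(d)$ and \<open>RL_right \<alpha> d f c\<close> is $J_{d-}^{\alpha} f(c)$,
  both for $c \le d$ (and $0$ for $c = d$, the interval then being a null set).  The value
  \<open>0 powr (\<alpha> - 1) = 0\<close> of the kernel at the singular endpoint does not affect the integral.
\<close>

definition RL_left :: "real \<Rightarrow> real \<Rightarrow> (real \<Rightarrow> real) \<Rightarrow> real \<Rightarrow> real" where
  "RL_left \<alpha> c f d = 1 / Gamma \<alpha> * (LBINT t:{c..d}. (d - t) powr (\<alpha> - 1) * f t)"

definition RL_right :: "real \<Rightarrow> real \<Rightarrow> (real \<Rightarrow> real) \<Rightarrow> real \<Rightarrow> real" where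
  "RL_right \<alpha> d f c = 1 / Gamma \<alpha> * (LBINT t:{c..d}. (t - c) powr (\<alpha> - 1) * f t)"

lemma RL_left_refl: "RL_left \<alpha> c f c = 0"
proof -
  have "(\<lambda>x. indicat_real {c} x * ((c - x) powr (\<alpha> - 1) * f x)) = (\<lambda>x. 0)"
    by (auto simp: indicator_def fun_eq_iff)
  then show ?thesis
    by (simp add: RL_left_def set_lebesgue_integral_def)
qed

lemma RL_right_refl: "RL_right \<alpha> c f c = 0"
proof -
  have "(\<lambda>x. indicat_real {c} x * ((x - c) powr (\<alpha> - 1) * f x)) = (\<lambda>x. 0)"
    by (auto simp: indicator_def fun_eq_iff)
  then show ?thesis
    by (simp add: RL_right_def set_lebesgue_integral_def)
qed

definition V_point :: "real \<Rightarrow> real \<Rightarrow> real \<Rightarrow> real" where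
  "V_point a b l = (1 - l) * a + l * b"

text \<open>
  The three cases of $V_{\alpha,\lambda}(x,y)$ overlap for $V = x$ and $V = y$.  The lemmas
  \<open>V_fun_case1\<close>, \<open>V_fun_case2\<close>, \<open>V_fun_case3\<close> show that the formulas agree there, so
  that each case holds under non-strict inequalities.
\<close>

definition V_fun :: "real \<Rightarrow> real \<Rightarrow> real \<Rightarrow> real \<Rightarrow> real \<Rightarrow> real \<Rightarrow> real" where
  "V_fun \<alpha> l a b x y = (let V = V_point a b l in
     if V \<le> x then
       (V - a) powr \<alpha> * ((x - a) / \<alpha> - (V - a) / (\<alpha> + 1))
       + 2 * (b - y) powr (\<alpha> + 1) / (\<alpha> * (\<alpha> + 1))
       + (b - V) powr \<alpha> * ((b - V) / (\<alpha> + 1) - (b - y) / \<alpha>)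
     else if V \<le> y then
       2 * (x - a) powr (\<alpha> + 1) / (\<alpha> * (\<alpha> + 1))
       + (V - a) powr \<alpha> * ((V - a) / (\<alpha> + 1) - (x - a) / \<alpha>)
       + 2 * (b - y) powr (\<alpha> + 1) / (\<alpha> * (\<alpha> + 1))
       + (b - V) powr \<alpha> * ((b - V) / (\<alpha> + 1) - (b - y) / \<alpha>)
     else
       2 * (x - a) powr (\<alpha> + 1) / (\<alpha> * (\<alpha> + 1))
       + (V - a) powr \<alpha> * ((V - a) / (\<alpha> + 1) - (x - a) / \<alpha>)
       + (b - V) powr \<alpha> * ((b - y) / \<alpha> - (b - V) / (\<alpha> + 1)))"

lemma V_fun_overlap:
  fixes w \<alpha> :: real
  assumes "\<alpha> > 0" "w \<ge> 0"
  shows "2 * w powr (\<alpha> + 1) / (\<alpha> * (\<alpha> + 1)) + w powr \<alpha> * (w / (\<alpha> + 1) - w / \<alpha>)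
         = w powr \<alpha> * (w / \<alpha> - w / (\<alpha> + 1))"
proof -
  have p: "w powr (\<alpha> + 1) = w * w powr \<alpha>"
    using assms(2) by (cases "w = 0") (auto simp: powr_add)
  have "\<alpha> \<noteq> 0" "\<alpha> + 1 \<noteq> 0" using assms(1) by auto
  then show ?thesis unfolding p by (simp add: divide_simps) (simp add: algebra_simps)
qed

lemma V_fun_case1:
  fixes a b l x y \<alpha> :: real
  defines "V \<equiv> V_point a b l"
  assumes "a \<le> V" "V \<le> x" "x \<le> y" "y \<le> b"
  shows "V_fun \<alpha> l a b x y =
    (V - a) powr \<alpha> * ((x - a) / \<alpha> - (V - a) / (\<alpha> + 1))
    + 2 * (b - y) powr (\<alpha> + 1) / (\<alpha> * (\<alpha> + 1))
    + (b - V) powr \<alpha> * ((b - V) / (\<alpha> + 1) - (b - y) / \<alpha>)"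
  using assms by (simp add: V_fun_def Let_def)

lemma V_fun_case2:
  fixes a b l x y \<alpha> :: real
  defines "V \<equiv> V_point a b l"
  assumes "\<alpha> > 0" "a \<le> x" "x \<le> V" "V \<le> y" "y \<le> b"
  shows "V_fun \<alpha> l a b x y =
    2 * (x - a) powr (\<alpha> + 1) / (\<alpha> * (\<alpha> + 1))
    + (V - a) powr \<alpha> * ((V - a) / (\<alpha> + 1) - (x - a) / \<alpha>)
    + 2 * (b - y) powr (\<alpha> + 1) / (\<alpha> * (\<alpha> + 1))
    + (b - V) powr \<alpha> * ((b - V) / (\<alpha> + 1) - (b - y) / \<alpha>)"
proof (cases "V = x")
  case True
  then show ?thesis
    using V_fun_overlap[of \<alpha> "x - a"] assms by (simp add: V_fun_def Let_def)
next
  case False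
  then show ?thesis using assms by (simp add: V_fun_def Let_def)
qed

lemma V_fun_case3:
  fixes a b l x y \<alpha> :: real
  defines "V \<equiv> V_point a b l"
  assumes "\<alpha> > 0" "a \<le> x" "x \<le> y" "y \<le> V" "V \<le> b"
  shows "V_fun \<alpha> l a b x y =
    2 * (x - a) powr (\<alpha> + 1) / (\<alpha> * (\<alpha> + 1))
    + (V - a) powr \<alpha> * ((V - a) / (\<alpha> + 1) - (x - a) / \<alpha>)
    + (b - V) powr \<alpha> * ((b - y) / \<alpha> - (b - V) / (\<alpha> + 1))"
proof (cases "V = y")
  case True
  have "V_fun \<alpha> l a b x y =
    2 * (x - a) powr (\<alpha> + 1) / (\<alpha> * (\<alpha> + 1))
    + (V - a) powr \<alpha> * ((V - a) / (\<alpha> + 1) - (x - a) / \<alpha>)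
    + 2 * (b - y) powr (\<alpha> + 1) / (\<alpha> * (\<alpha> + 1))
    + (b - V) powr \<alpha> * ((b - V) / (\<alpha> + 1) - (b - y) / \<alpha>)"
    unfolding V_def using True assms by (intro V_fun_case2) (auto simp: V_def)
  then show ?thesis
    using V_fun_overlap[of \<alpha> "b - y"] assms True by simp
next
  case False
  then show ?thesis using assms by (simp add: V_fun_def Let_def)
qed

end

theory Submission
  imports Defs
begin

text \<open>
  Since $(V-a)^\alpha = \alpha\int_a^V (t-a)^{\alpha-1}\,dt$ and
  $(b-V)^\alpha = \alpha\int_V^b (b-t)^{\alpha-1}\,dt$, the left-hand side equals
  $\frac{\alpha}{(b-a)^\alpha}$ times the absolute value of
  $\int_a^V (t-a)^{\alpha-1}(f(x)-f(t))\,dt + \int_V^b (b-t)^{\alpha-1}(f(y)-f(t))\,dt$.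
  The Lipschitz bound reduces both terms, after the substitutions $s=t-a$ and $s=b-t$, to the
  integral $\int_0^w s^{\alpha-1}|p-s|\,ds$, which is evaluated for $w\le p$ and for $p\le w$.
\<close>

lemma has_integral_powr_kernel:
  fixes \<alpha> w :: real
  assumes "\<alpha> > 0" "w \<ge> 0"
  shows "((\<lambda>s. s powr (\<alpha> - 1)) has_integral w powr \<alpha> / \<alpha>) {0..w}"
  using has_integral_powr_from_0[of "\<alpha> - 1" w] assms by simp

lemma has_integral_powr_kernel_linear:
  fixes \<alpha> w p :: real
  assumes "\<alpha> > 0" "w \<ge> 0"
  shows "((\<lambda>s. s powr (\<alpha> - 1) * (p - s)) has_integral w powr \<alpha> * (p / \<alpha> - w / (\<alpha> + 1))) {0..w}"
proof -
  have "((\<lambda>s. p * s powr (\<alpha> - 1) - s powr \<alpha>) has_integral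
      p * (w powr \<alpha> / \<alpha>) - w powr (\<alpha> + 1) / (\<alpha> + 1)) {0..w}"
    using assms
    by (intro has_integral_diff has_integral_mult_right has_integral_powr_kernel
        has_integral_powr_from_0) auto
  \<comment> \<open>At s = 0 both sides vanish because \<open>0 powr\<close> anything is 0; for s >
    0 the factor s is absorbed into the power.\<close>
  moreover have "p * s powr (\<alpha> - 1) - s powr \<alpha> = s powr (\<alpha> - 1) * (p - s)"
    if "s \<in> {0..w}" for s
    using that by (cases "s = 0") (auto simp: powr_diff field_simps)
  moreover have "w powr (\<alpha> + 1) = w * w powr \<alpha>"
    using assms by (cases "w = 0") (auto simp: powr_add)
  ultimately show ?thesis
    by (subst has_integral_cong[where g = "\<lambda>s. p * s powr (\<alpha> - 1) - s powr \<alpha>"])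
       (auto simp: algebra_simps)
qed

lemma has_integral_powr_kernel_abs_ge:
  fixes \<alpha> w p :: real
  assumes "\<alpha> > 0" "w \<ge> 0" "w \<le> p"
  shows "((\<lambda>s. s powr (\<alpha> - 1) * \<bar>p - s\<bar>) has_integral w powr \<alpha> * (p / \<alpha> - w / (\<alpha> + 1))) {0..w}"
  using has_integral_powr_kernel_linear[of \<alpha> w p] assms
  by (subst has_integral_cong[where g = "\<lambda>s. s powr (\<alpha> - 1) * (p - s)"]) auto

text \<open>Since |p - s| is twice the positive part of p - s, minus p - s, the integral is twice
  the linear kernel integral over \<open>{0..p}\<close> minus the one over
  \<open>{0..w}\<close>.\<close>

lemma has_integral_powr_kernel_abs_le:
  fixes \<alpha> w p :: real
  assumes "\<alpha> > 0" "0 \<le> p" "p \<le> w"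
  shows "((\<lambda>s. s powr (\<alpha> - 1) * \<bar>p - s\<bar>) has_integral
    2 * p powr (\<alpha> + 1) / (\<alpha> * (\<alpha> + 1)) + w powr \<alpha> * (w / (\<alpha> + 1) - p / \<alpha>)) {0..w}"
proof -
  let ?k = "\<lambda>s. s powr (\<alpha> - 1) * (p - s)"
  have "((\<lambda>s. if s \<in> {0..p} then ?k s else 0) has_integral
      p powr \<alpha> * (p / \<alpha> - p / (\<alpha> + 1))) {0..w}"
    using has_integral_powr_kernel_linear[of \<alpha> p p] assms
    by (subst has_integral_restrict) auto
  from has_integral_diff[OF has_integral_mult_right[OF this, of 2]
      has_integral_powr_kernel_linear[of \<alpha> w p]]
  have "((\<lambda>s. 2 * (if s \<in> {0..p} then ?k s else 0) - ?k s) has_integral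
      2 * (p powr \<alpha> * (p / \<alpha> - p / (\<alpha> + 1))) - w powr \<alpha> * (p / \<alpha> - w / (\<alpha> + 1))) {0..w}"
    using assms by simp
  \<comment> \<open>The overlap identity at \<open>p\<close> says exactly that the doubled term
    equals \<open>2 * p powr (\<alpha> + 1) / (\<alpha> * (\<alpha> + 1))\<close>.\<close>
  moreover have "2 * (p powr \<alpha> * (p / \<alpha> - p / (\<alpha> + 1))) - w powr \<alpha> * (p / \<alpha> - w / (\<alpha> + 1))
      = 2 * p powr (\<alpha> + 1) / (\<alpha> * (\<alpha> + 1)) + w powr \<alpha> * (w / (\<alpha> + 1) - p / \<alpha>)"
    using V_fun_overlap[of \<alpha> p] assms by (simp add: algebra_simps)
  ultimately show ?thesis
    by (subst has_integral_cong[where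
          g = "\<lambda>s. 2 * (if s \<in> {0..p} then ?k s else 0) - ?k s"])
       (auto simp: algebra_simps abs_if)
qed

text \<open>Bridges the gauge integrals computed above and the Lebesgue integrals in the
  Riemann-Liouville definitions. Nonnegativity makes gauge integrability absolute, and Borel
  measurability allows the passage from the completed measure to \<open>lborel\<close>.\<close>

lemma nonneg_has_integral_imp_set_lebesgue:
  fixes h :: "real \<Rightarrow> real"
  assumes "(h has_integral B) {c..d}" "\<And>s. s \<in> {c..d} \<Longrightarrow> 0 \<le> h s" "h \<in> borel_measurable borel"
  shows "set_integrable lborel {c..d} h" "(LBINT s:{c..d}. h s) = B"
proof -
  have "h absolutely_integrable_on {c..d}"
    using assms by (intro nonnegative_absolutely_integrable_1) (auto simp: has_integral_integrable)
  then have "set_integrable lebesgue {c..d} h" .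
  then show *: "set_integrable lborel {c..d} h"
    using assms(3) unfolding set_integrable_def
    by (subst (asm) integrable_completion) auto
  show "(LBINT s:{c..d}. h s) = B"
    using set_borel_integral_eq_integral(2)[OF *] assms(1) integral_unique by auto
qed

text \<open>The kernel has mass \<open>w powr \<alpha> / \<alpha>\<close>, so the difference is the
  kernel integral of g p - g s, which the Lipschitz condition dominates by M times that of |p - s|.
  The set \<open>S\<close> is separate from \<open>{0..w}\<close> because \<open>p\<close> may
  exceed \<open>w\<close>; \<open>B\<close> is left open to admit either evaluation.\<close>

lemma lipschitz_powr_kernel_bound:
  fixes g :: "real \<Rightarrow> real" and \<alpha> w p M B :: real
  assumes "\<alpha> > 0" "w \<ge> 0" and lip: "M-lipschitz_on S g" and sub: "{0..w} \<subseteq> S" "p \<in> S"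
    and B: "((\<lambda>s. s powr (\<alpha> - 1) * \<bar>p - s\<bar>) has_integral B) {0..w}"
  shows "\<bar>w powr \<alpha> / \<alpha> * g p - (LBINT s:{0..w}. s powr (\<alpha> - 1) * g s)\<bar> \<le> M * B"
proof -
  let ?k = "\<lambda>s. s powr (\<alpha> - 1)"
  have k: "set_integrable lborel {0..w} ?k" "(LBINT s:{0..w}. ?k s) = w powr \<alpha> / \<alpha>"
    using nonneg_has_integral_imp_set_lebesgue[OF has_integral_powr_kernel] assms by auto
  have b: "set_integrable lborel {0..w} (\<lambda>s. ?k s * \<bar>p - s\<bar>)"
    "(LBINT s:{0..w}. ?k s * \<bar>p - s\<bar>) = B"
    using nonneg_has_integral_imp_set_lebesgue[OF B] by auto
  have cont: "continuous_on {0..w} g"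
    using lipschitz_on_continuous_on lip sub continuous_on_subset by blast
  have le: "\<bar>?k s * (g p - g s)\<bar> \<le> M * (?k s * \<bar>p - s\<bar>)" if "s \<in> {0..w}" for s
  proof -
    have "\<bar>g p - g s\<bar> \<le> M * \<bar>p - s\<bar>"
      using lipschitz_onD[OF lip, of p s] that sub by (auto simp: dist_real_def)
    then have "?k s * \<bar>g p - g s\<bar> \<le> ?k s * (M * \<bar>p - s\<bar>)"
      by (intro mult_left_mono) auto
    then show ?thesis by (simp add: abs_mult mult_ac)
  qed
  \<comment> \<open>For \<alpha> < 1 the kernel is unbounded near 0, so the indicator is attached to
    the continuous factor alone and the Borel kernel is multiplied in afterwards.\<close>
  have meas: "set_borel_measurable lborel {0..w} (\<lambda>s. ?k s * (g p - g s))"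
  proof -
    have "(\<lambda>s. indicat_real {0..w} s *\<^sub>R (g p - g s)) \<in> borel_measurable borel"
      by (intro borel_measurable_continuous_on_indicator continuous_intros cont) auto
    then have "(\<lambda>s. ?k s * (indicat_real {0..w} s *\<^sub>R (g p - g s))) \<in> borel_measurable borel"
      by measurable
    then show ?thesis
      by (simp add: set_borel_measurable_def mult_ac)
  qed
  have Mb: "set_integrable lborel {0..w} (\<lambda>s. M * (?k s * \<bar>p - s\<bar>))"
    using b by simp
  have d: "set_integrable lborel {0..w} (\<lambda>s. ?k s * (g p - g s))"
    using le by (intro set_integrable_bound[OF Mb meas]) (fastforce intro!: AE_I2)
  have kp: "set_integrable lborel {0..w} (\<lambda>s. ?k s * g p)"
    using k by simp
  \<comment> \<open>Writing g s as g p - (g p - g s) leaves two pieces whose integrability is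
    already established.\<close>
  have "(LBINT s:{0..w}. ?k s * g s) =
      (LBINT s:{0..w}. ?k s * g p - ?k s * (g p - g s))"
    by (simp add: algebra_simps)
  also have "\<dots> = w powr \<alpha> / \<alpha> * g p - (LBINT s:{0..w}. ?k s * (g p - g s))"
    by (subst set_integral_diff(2)[OF kp d]) (simp add: k)
  finally have "\<bar>w powr \<alpha> / \<alpha> * g p - (LBINT s:{0..w}. ?k s * g s)\<bar>
      = \<bar>LBINT s:{0..w}. ?k s * (g p - g s)\<bar>" by simp
  also have "\<dots> \<le> (LBINT s:{0..w}. \<bar>?k s * (g p - g s)\<bar>)"
    using set_integral_norm_bound[OF d] by simp
  also have "\<dots> \<le> (LBINT s:{0..w}. M * (?k s * \<bar>p - s\<bar>))"
    using le by (intro set_integral_mono set_integrable_abs d Mb) auto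
  also have "\<dots> = M * B" using b by simp
  finally show ?thesis .
qed

text \<open>Translation moves the singular endpoint \<open>c\<close> to 0. With the reflection
  below, both fractional integrals take the same form, so one estimate serves both.\<close>

lemma RL_right_shift:
  "RL_right \<alpha> d f c = 1 / Gamma \<alpha> * (LBINT s:{0..d - c}. s powr (\<alpha> - 1) * f (c + s))"
proof -
  have "(LBINT t:{c..d}. (t - c) powr (\<alpha> - 1) * f t)
      = (LBINT s:{0..d - c}. s powr (\<alpha> - 1) * f (c + s))"
    unfolding set_lebesgue_integral_def
    by (subst lborel_integral_real_affine[of 1 _ c])
       (auto intro!: Bochner_Integration.integral_cong simp: indicator_def)
  then show ?thesis by (simp add: RL_right_def)
qed

lemma RL_left_reflect:
  "RL_left \<alpha> c f d = 1 / Gamma \<alpha> * (LBINT s:{0..d - c}. s powr (\<alpha> - 1) * f (d - s))"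
proof -
  have "(LBINT t:{c..d}. (d - t) powr (\<alpha> - 1) * f t)
      = (LBINT s:{0..d - c}. s powr (\<alpha> - 1) * f (d - s))"
    unfolding set_lebesgue_integral_def
    by (subst lborel_integral_real_affine[of "-1" _ d])
       (auto intro!: Bochner_Integration.integral_cong simp: indicator_def)
  then show ?thesis by (simp add: RL_left_def)
qed

theorem theorem5:
  fixes I :: "real set" and f :: "real \<Rightarrow> real" and a b x y M \<alpha> l :: real
  assumes "is_interval I" and "a \<in> I" and "b \<in> I" and "a < b"
    and "a \<le> x" and "x \<le> y" and "y \<le> b"
    and "M-lipschitz_on I f"
    and "\<alpha> > 0" and "l \<in> {0..1}"
  shows "\<bar>l powr \<alpha> * f x + (1 - l) powr \<alpha> * f y
          - Gamma (\<alpha> + 1) / (b - a) powr \<alpha>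
            * (RL_right \<alpha> (V_point a b l) f a + RL_left \<alpha> (V_point a b l) f b)\<bar>
         \<le> \<alpha> * M * V_fun \<alpha> l a b x y / (b - a) powr \<alpha>"
proof -
  define V where "V = V_point a b l"
  define L where "L = (LBINT s:{0..V - a}. s powr (\<alpha> - 1) * f (a + s))"
  define R where "R = (LBINT s:{0..b - V}. s powr (\<alpha> - 1) * f (b - s))"
  define D where "D = (b - a) powr \<alpha>"
  have Va: "V - a = l * (b - a)" and bV: "b - V = (1 - l) * (b - a)"
    by (auto simp: V_def V_point_def algebra_simps)
  have V: "a \<le> V" "V \<le> b"
    using Va bV assms by (smt (verit) atLeastAtMost_iff mult_nonneg_nonneg)+
  \<comment> \<open>\<open>V\<close> divides the interval in the ratio l : (1 - l), so the weights
    are the kernel masses of the two parts up to the common factor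
    \<open>\<alpha> / D\<close>.\<close>
  have lp: "l powr \<alpha> = (V - a) powr \<alpha> / D" "(1 - l) powr \<alpha> = (b - V) powr \<alpha> / D"
    using assms by (auto simp: Va bV D_def powr_mult)
  have sub: "{a..b} \<subseteq> I"
    using assms(1-3) unfolding is_interval_1 by (meson atLeastAtMost_iff subsetI)
  then have lip: "M-lipschitz_on {a..b} f"
    using assms lipschitz_on_subset by blast
  \<comment> \<open>The full range \<open>{0..b - a}\<close> is taken so that it contains
    \<open>x - a\<close> even when x lies beyond \<open>V\<close>; likewise for \<open>b - y\<close>
    below.\<close>
  have lipL: "M-lipschitz_on {0..b - a} (\<lambda>s. f (a + s))"
  proof (rule lipschitz_onI)
    show "dist (f (a + s)) (f (a + t)) \<le> M * dist s t"
      if "s \<in> {0..b - a}" "t \<in> {0..b - a}" for s t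
      using lipschitz_onD[OF lip, of "a + s" "a + t"] that by (simp add: dist_real_def)
  qed (use lip lipschitz_on_nonneg in blast)
  have lipR: "M-lipschitz_on {0..b - a} (\<lambda>s. f (b - s))"
  proof (rule lipschitz_onI)
    show "dist (f (b - s)) (f (b - t)) \<le> M * dist s t"
      if "s \<in> {0..b - a}" "t \<in> {0..b - a}" for s t
      using lipschitz_onD[OF lip, of "b - s" "b - t"] that
      by (simp add: dist_real_def abs_minus_commute)
  qed (use lip lipschitz_on_nonneg in blast)
  have boundL: "\<bar>(V - a) powr \<alpha> / \<alpha> * f x - L\<bar> \<le> M * B"
    if "((\<lambda>s. s powr (\<alpha> - 1) * \<bar>(x - a) - s\<bar>) has_integral B) {0..V - a}" for B
    using lipschitz_powr_kernel_bound[OF \<open>\<alpha> > 0\<close> _ lipL _ _ that] V assms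
    by (simp add: L_def)
  have boundR: "\<bar>(b - V) powr \<alpha> / \<alpha> * f y - R\<bar> \<le> M * B"
    if "((\<lambda>s. s powr (\<alpha> - 1) * \<bar>(b - y) - s\<bar>) has_integral B) {0..b - V}" for B
    using lipschitz_powr_kernel_bound[OF \<open>\<alpha> > 0\<close> _ lipR _ _ that] V assms
    by (simp add: R_def)
  note abs_ge = has_integral_powr_kernel_abs_ge[OF \<open>\<alpha> > 0\<close>]
  note abs_le = has_integral_powr_kernel_abs_le[OF \<open>\<alpha> > 0\<close>]
  \<comment> \<open>The position of \<open>V\<close> decides for each of x and y whether |p - s|
    changes sign on its range: \<open>abs_ge\<close> applies if x or y lies outside the part
    assigned to it, \<open>abs_le\<close> if inside. The two values of \<open>B\<close> add up to
    the matching formula of \<open>V_fun\<close>.\<close>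
  consider "V \<le> x" | "x \<le> V" "V \<le> y" | "y \<le> V" by linarith
  then have "\<bar>(V - a) powr \<alpha> / \<alpha> * f x - L\<bar> + \<bar>(b - V) powr \<alpha> / \<alpha> * f y - R\<bar>
      \<le> M * V_fun \<alpha> l a b x y"
  proof cases
    case 1
    then show ?thesis
      using boundL[OF abs_ge] boundR[OF abs_le] V_fun_case1[of a b l x y \<alpha>] V assms
      by (simp add: V_def[symmetric] distrib_left)
  next
    case 2
    then show ?thesis
      using boundL[OF abs_le] boundR[OF abs_le] V_fun_case2[of \<alpha> a x b l y] V assms
      by (simp add: V_def[symmetric] distrib_left)
  next
    case 3
    then show ?thesis
      using boundL[OF abs_le] boundR[OF abs_ge] V_fun_case3[of \<alpha> a x y b l] V assms
      by (simp add: V_def[symmetric] distrib_left)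
  qed
  then have core: "\<bar>((V - a) powr \<alpha> / \<alpha> * f x - L) + ((b - V) powr \<alpha> / \<alpha> * f y - R)\<bar>
      \<le> M * V_fun \<alpha> l a b x y"
    by linarith
  have "Gamma \<alpha> \<noteq> 0" using Gamma_real_pos[OF \<open>\<alpha> > 0\<close>] by simp
  \<comment> \<open>The functional equation cancels the factor \<open>1 / Gamma \<alpha>\<close> of
    the fractional integrals and leaves \<open>\<alpha> / D\<close> in front.\<close>
  moreover have "Gamma (\<alpha> + 1) = \<alpha> * Gamma \<alpha>"
    using \<open>\<alpha> > 0\<close> by (intro Gamma_plus1) (auto elim!: nonpos_Ints_cases)
  moreover have "D > 0" using assms by (simp add: D_def)
  ultimately have "l powr \<alpha> * f x + (1 - l) powr \<alpha> * f y
      - Gamma (\<alpha> + 1) / D * (RL_right \<alpha> V f a + RL_left \<alpha> V f b)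
      = \<alpha> / D * (((V - a) powr \<alpha> / \<alpha> * f x - L) + ((b - V) powr \<alpha> / \<alpha> * f y - R))"
    using \<open>\<alpha> > 0\<close> unfolding lp RL_right_shift RL_left_reflect L_def[symmetric] R_def[symmetric]
    by (simp add: field_simps)
  then have "\<bar>l powr \<alpha> * f x + (1 - l) powr \<alpha> * f y
      - Gamma (\<alpha> + 1) / D * (RL_right \<alpha> V f a + RL_left \<alpha> V f b)\<bar>
      \<le> \<alpha> / D * (M * V_fun \<alpha> l a b x y)"
    using core \<open>D > 0\<close> \<open>\<alpha> > 0\<close> by (simp add: abs_mult divide_right_mono)
  then show ?thesis by (simp add: V_def D_def mult_ac)
qed

end
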